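(* Let $\mathfrak{A}$ be a residuated lattice. The following assertions are equivalent: (1) $\mathfrak{A}$ is quasicomplemented; (2) any prime filter of $\mathfrak{A}$ not containing any dense element is a minimal prime filter; (3) any filter of $\mathfrak{A}$ not containing any dense element is contained in a minimal prime filter.
   Context: A residuated lattice $\mathfrak{A}=(A;\vee,\wedge,\odot,\rightarrow,0,1)$ is an algebra such that $(A;\vee,\wedge,0,1)$ is a bounded lattice, $(A;\odot,1)$ is a commutative monoid, and $x\odot y\leq z$ iff $x\leq y\rightarrow z$. A filter is a non-empty $F\subseteq A$ closed under $\odot$ and such that $x\in F$, $y\in A$ imply $x\vee y\in F$; it is proper if $F\neq A$. A prime filter is a proper filter $P$ such that $x\vee y\in P$ implies $x\in P$ or $y\in P$; a minimal prime filter is a prime filter minimal under inclusion among all prime filters. For $X\subseteq A$, $X^{\perp}=\{a\in A\mid a\vee x=1\ \forall x\in X\}$; $x^{\perp}:=\{x\}^{\perp}$ and $x^{\perp\perp}:=(x^{\perp})^{\perp}$. An element $x$ is dense if $x^{\perp}=\{1\}$. $\mathfrak{A}$ is quasicomplemented if for every $x\in A$ there is $y\in A$ with $x^{\perp\perp}=y^{\perp}$. *)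

theory Defs
  imports Main
begin

text \<open>
  The carrier of a residuated lattice is the whole type \<open>'a\<close>. The constants 0 and 1 are
  \<^const>\<open>bot\<close> and \<^const>\<open>top\<close>; in particular \<^const>\<open>top\<close> is also the unit of the monoid.
  Nothing excludes the one-element algebra.
\<close>

class residuated_lattice = bounded_lattice +
  fixes odot :: "'a \<Rightarrow> 'a \<Rightarrow> 'a"  (infixl \<open>\<odot>\<close> 70)
    and residuum :: "'a \<Rightarrow> 'a \<Rightarrow> 'a"  (infixr \<open>\<rightarrow>\<close> 60)
  assumes odot_assoc: "(x \<odot> y) \<odot> z = x \<odot> (y \<odot> z)"
    and odot_commute: "x \<odot> y = y \<odot> x"
    and odot_top: "x \<odot> top = x"
    and residuation: "x \<odot> y \<le> z \<longleftrightarrow> x \<le> y \<rightarrow> z"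

definition rl_filter :: "'a::residuated_lattice set \<Rightarrow> bool" where
  "rl_filter F \<longleftrightarrow> F \<noteq> {} \<and> (\<forall>x\<in>F. \<forall>y\<in>F. x \<odot> y \<in> F) \<and> (\<forall>x\<in>F. \<forall>y. sup x y \<in> F)"

definition prime_filter :: "'a::residuated_lattice set \<Rightarrow> bool" where
  "prime_filter P \<longleftrightarrow>
     rl_filter P \<and> P \<noteq> UNIV \<and> (\<forall>x y. sup x y \<in> P \<longrightarrow> x \<in> P \<or> y \<in> P)"

definition minimal_prime_filter :: "'a::residuated_lattice set \<Rightarrow> bool" where
  "minimal_prime_filter P \<longleftrightarrow>
     prime_filter P \<and> (\<forall>Q. prime_filter Q \<and> Q \<subseteq> P \<longrightarrow> Q = P)"

definition perp :: "'a::residuated_lattice set \<Rightarrow> 'a set" where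
  "perp X = {a. \<forall>x\<in>X. sup a x = top}"

definition dense_element :: "'a::residuated_lattice \<Rightarrow> bool" where
  "dense_element x \<longleftrightarrow> perp {x} = {top}"

text \<open>A property of the whole algebra, hence a predicate on the type.\<close>

definition quasicomplemented :: "'a::residuated_lattice itself \<Rightarrow> bool" where
  "quasicomplemented _ \<longleftrightarrow> (\<forall>x::'a. \<exists>y::'a. perp (perp {x}) = perp {y})"

end

theory Submission
  imports Defs
begin

text \<open>
  Prime filters avoiding a join-closed set exist by Zorn's lemma. Taking the set of dense elements
  gives (2) \<open>\<Longrightarrow>\<close> (3); taking the join-closed set generated by \<open>x\<close> and the complement of a minimal
  prime filter \<open>P\<close> with \<open>x \<in> P\<close> gives some \<open>y \<notin> P\<close> with \<open>x \<squnion> y = 1\<close>. For (1) \<open>\<Longrightarrow>\<close> (2), if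
  \<open>x\<^sup>\<bottom>\<^sup>\<bottom> = y\<^sup>\<bottom>\<close> then \<open>x \<squnion> y = 1\<close> and \<open>x \<odot> y\<close> is dense. For (3) \<open>\<Longrightarrow>\<close> (1), no minimal prime filter
  contains both \<open>x\<close> and \<open>x\<^sup>\<bottom>\<close>, so the filter \<open>\<Union>{{x, y}\<^sup>\<bottom>\<^sup>\<bottom> | y \<in> x\<^sup>\<bottom>}\<close> has a dense element; the
  corresponding \<open>y\<close> satisfies \<open>x\<^sup>\<bottom>\<^sup>\<bottom> = y\<^sup>\<bottom>\<close>. Using such double-perp filters and, in Zorn's lemma, the
  filters \<open>{z. \<forall>w. x \<squnion> w \<in> F \<longrightarrow> z \<squnion> w \<in> F}\<close>, avoids computing with powers of elements.
\<close>

section \<open>Products and joins\<close>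

lemma odot_left_mono:
  fixes a b c :: "'a::residuated_lattice"
  assumes "a \<le> b"
  shows "a \<odot> c \<le> b \<odot> c"
  by (meson assms order.trans order_refl residuation)

lemma odot_right_mono:
  fixes a b c :: "'a::residuated_lattice"
  assumes "a \<le> b"
  shows "c \<odot> a \<le> c \<odot> b"
  by (metis assms odot_commute odot_left_mono)

lemma odot_le_left: "(x::'a::residuated_lattice) \<odot> y \<le> x"
  by (metis odot_right_mono odot_top top_greatest)

lemma odot_le_right: "(x::'a::residuated_lattice) \<odot> y \<le> y"
  by (metis odot_le_left odot_commute)

lemma sup_odot_le_iff:
  "sup x y \<odot> u \<le> z \<longleftrightarrow> x \<odot> u \<le> z \<and> y \<odot> u \<le> (z::'a::residuated_lattice)"
  by (simp add: residuation)

lemma odot_sup_le_iff: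
  "u \<odot> sup x y \<le> z \<longleftrightarrow> u \<odot> x \<le> z \<and> u \<odot> y \<le> (z::'a::residuated_lattice)"
  by (metis sup_odot_le_iff odot_commute)

text \<open>Products distribute over joins; of the four resulting products, all but
  \<open>a \<odot> b\<close> have a factor \<open>w\<close> and so lie below
  \<open>w\<close>.\<close>

lemma sup_odot_sup_le:
  "sup a w \<odot> sup b w \<le> sup (a \<odot> b) (w::'a::residuated_lattice)"
  by (auto simp: sup_odot_le_iff odot_sup_le_iff intro: le_supI2 odot_le_left odot_le_right)

text \<open>Hence \<open>perp {a \<odot> b}\<close> is the intersection of \<open>perp {a}\<close>
  and \<open>perp {b}\<close>.\<close>

lemma sup_odot_eq_top_iff:
  "sup w (a \<odot> b) = top \<longleftrightarrow> sup w a = top \<and> sup w b = (top::'a::residuated_lattice)"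
proof
  assume *: "sup w (a \<odot> b) = top"
  have "sup w (a \<odot> b) \<le> sup w a" "sup w (a \<odot> b) \<le> sup w b"
    by (auto intro: le_supI2 odot_le_left odot_le_right)
  with * show "sup w a = top \<and> sup w b = top"
    by (simp add: top_unique)
next
  assume *: "sup w a = top \<and> sup w b = top"
  then have "top \<odot> top \<le> sup (a \<odot> b) w"
    using sup_odot_sup_le[of a w b] by (simp add: sup_commute)
  then show "sup w (a \<odot> b) = top"
    by (simp add: odot_top top_unique sup_commute)
qed

section \<open>Perps and dense elements\<close>

lemma mem_perp_singleton: "a \<in> perp {x} \<longleftrightarrow> sup a x = top"
  by (simp add: perp_def)

lemma dense_element_iff:
  "dense_element x \<longleftrightarrow> (\<forall>a. sup a x = top \<longrightarrow> a = top)"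
  by (auto simp: dense_element_def perp_def)

lemma dense_element_bot: "dense_element bot"
  by (simp add: dense_element_iff)

lemma dense_element_sup:
  assumes "dense_element x" "dense_element y"
  shows "dense_element (sup x y)"
  using assms unfolding dense_element_iff by (metis sup_assoc)

section \<open>Filters and prime filters\<close>

lemma rl_filterI:
  assumes "top \<in> F"
    and "\<And>x y. \<lbrakk>x \<in> F; y \<in> F\<rbrakk> \<Longrightarrow> x \<odot> y \<in> F"
    and "\<And>x y. x \<in> F \<Longrightarrow> sup x y \<in> F"
  shows "rl_filter F"
  using assms unfolding rl_filter_def by blast

lemma rl_filter_odot: "\<lbrakk>rl_filter F; x \<in> F; y \<in> F\<rbrakk> \<Longrightarrow> x \<odot> y \<in> F"
  by (simp add: rl_filter_def)

lemma rl_filter_sup: "\<lbrakk>rl_filter F; x \<in> F\<rbrakk> \<Longrightarrow> sup x y \<in> F"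
  by (simp add: rl_filter_def)

lemma rl_filter_upward: "\<lbrakk>rl_filter F; x \<in> F; x \<le> y\<rbrakk> \<Longrightarrow> y \<in> F"
  by (metis rl_filter_sup sup.absorb2)

lemma rl_filter_top: "rl_filter F \<Longrightarrow> top \<in> F"
  by (metis all_not_in_conv rl_filter_def rl_filter_upward top_greatest)

lemma rl_filter_singleton_top: "rl_filter {top}"
  by (rule rl_filterI) (simp_all add: odot_top)

lemma rl_filter_Union_chain:
  assumes "\<C> \<noteq> {}" "\<And>F. F \<in> \<C> \<Longrightarrow> rl_filter F"
    and "\<And>F G. \<lbrakk>F \<in> \<C>; G \<in> \<C>\<rbrakk> \<Longrightarrow> F \<subseteq> G \<or> G \<subseteq> F"
  shows "rl_filter (\<Union>\<C>)"
proof (rule rl_filterI)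
  show "top \<in> \<Union>\<C>"
    using assms(1,2) rl_filter_top by blast
next
  fix x y assume "x \<in> \<Union>\<C>" "y \<in> \<Union>\<C>"
  then obtain F G where "F \<in> \<C>" "x \<in> F" "G \<in> \<C>" "y \<in> G" by blast
  with assms(3)[of F G] show "x \<odot> y \<in> \<Union>\<C>"
    using assms(2) rl_filter_odot by blast
next
  fix x y assume "x \<in> \<Union>\<C>"
  then show "sup x y \<in> \<Union>\<C>"
    using assms(2) rl_filter_sup by blast
qed

text \<open>This filter contains \<open>F\<close> and \<open>x\<close> and stands in for the one
  they generate. For products, \<open>sup a w \<odot> sup b w\<close> lies in \<open>F\<close> and
  below \<open>sup (a \<odot> b) w\<close>.\<close>

lemma rl_filter_residual:
  assumes F: "rl_filter F"
  shows "rl_filter {z. \<forall>w. sup x w \<in> F \<longrightarrow> sup z w \<in> F}" (is "rl_filter ?G")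
proof (rule rl_filterI)
  show "top \<in> ?G"
    using rl_filter_top[OF F] by simp
next
  fix a b assume "a \<in> ?G" "b \<in> ?G"
  then show "a \<odot> b \<in> ?G"
    using rl_filter_upward[OF F rl_filter_odot[OF F] sup_odot_sup_le] by blast
next
  fix a b assume "a \<in> ?G"
  moreover have "sup (sup a b) w = sup (sup a w) b" for w by (simp add: ac_simps)
  ultimately show "sup a b \<in> ?G"
    using rl_filter_sup[OF F] by simp
qed

text \<open>A filter maximal among those that contain \<open>F\<close> and avoid \<open>D\<close> is
  prime: two elements outside it would yield two members of \<open>D\<close> whose join lies in
  it.\<close>

theorem prime_filter_avoiding:
  fixes F D :: "'a::residuated_lattice set"
  assumes F: "rl_filter F" and disj: "F \<inter> D = {}" and ne: "D \<noteq> {}"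
    and sup_closed: "\<And>x y. \<lbrakk>x \<in> D; y \<in> D\<rbrakk> \<Longrightarrow> sup x y \<in> D"
  obtains P where "prime_filter P" "F \<subseteq> P" "P \<inter> D = {}"
proof -
  let ?\<A> = "{G. rl_filter G \<and> F \<subseteq> G \<and> G \<inter> D = {}}"
  have "\<exists>M\<in>?\<A>. \<forall>X\<in>?\<A>. M \<subseteq> X \<longrightarrow> X = M"
  proof (rule subset_Zorn_nonempty)
    show "?\<A> \<noteq> {}" using F disj by blast
  next
    fix \<C> assume "\<C> \<noteq> {}" and chain: "subset.chain ?\<A> \<C>"
    moreover from this have "rl_filter (\<Union>\<C>)"
      by (intro rl_filter_Union_chain) (auto simp: subset_chain_def)
    ultimately show "\<Union>\<C> \<in> ?\<A>"
      by (fastforce simp: subset_chain_def)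
  qed
  then obtain M where "M \<in> ?\<A>" and max: "\<forall>X\<in>?\<A>. M \<subseteq> X \<longrightarrow> X = M" ..
  then have M: "rl_filter M" "F \<subseteq> M" "M \<inter> D = {}" by simp_all
  have meets: "\<exists>d\<in>D. \<forall>w. sup x w \<in> M \<longrightarrow> sup d w \<in> M" if "x \<notin> M" for x
  proof -
    let ?G = "{z. \<forall>w. sup x w \<in> M \<longrightarrow> sup z w \<in> M}"
    have "M \<subseteq> ?G" using rl_filter_sup[OF M(1)] by blast
    moreover have "x \<in> ?G" by simp
    moreover have "rl_filter ?G" by (rule rl_filter_residual[OF M(1)])
    \<comment> \<open>If \<open>?G\<close> avoided \<open>D\<close>, maximality would give
      \<open>?G = M\<close>, although \<open>x\<close> is in \<open>?G\<close> and not in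
      \<open>M\<close>.\<close>
    ultimately have "?G \<inter> D \<noteq> {}"
      using bspec[OF max, of ?G] M(2) that by auto
    then show ?thesis by blast
  qed
  have "x \<in> M \<or> y \<in> M" if xy: "sup x y \<in> M" for x y
  proof (rule ccontr)
    assume "\<not> (x \<in> M \<or> y \<in> M)"
    then obtain d e where d: "d \<in> D" "\<And>w. sup x w \<in> M \<Longrightarrow> sup d w \<in> M"
      and e: "e \<in> D" "\<And>w. sup y w \<in> M \<Longrightarrow> sup e w \<in> M"
      using meets by meson
    \<comment> \<open>First \<open>x\<close> is traded for \<open>d\<close> with
      \<open>w = y\<close>, then \<open>y\<close> for \<open>e\<close> with
      \<open>w = d\<close>.\<close>
    have "sup y d \<in> M" using d(2)[OF xy] by (simp add: sup_commute)
    then have "sup e d \<in> M" by (rule e(2))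
    with sup_closed[OF e(1) d(1)] M(3) show False by blast
  qed
  moreover have "M \<noteq> UNIV" using M(3) ne by blast
  ultimately have "prime_filter M" using M(1) by (simp add: prime_filter_def)
  with M that show thesis by blast
qed

section \<open>Minimal prime filters\<close>

lemma prime_filter_bot: "prime_filter P \<Longrightarrow> bot \<notin> P"
  unfolding prime_filter_def using rl_filter_upward bot_least by blast

text \<open>A prime filter \<open>Q\<close> inside \<open>P\<close> contains
  \<open>sup x y = top\<close> but not \<open>y\<close>, hence it contains \<open>x\<close>.\<close>

lemma minimal_prime_filterI:
  assumes P: "prime_filter P" and "\<And>x. x \<in> P \<Longrightarrow> \<exists>y. y \<notin> P \<and> sup x y = top"
  shows "minimal_prime_filter P"
  unfolding minimal_prime_filter_def
proof (intro conjI allI impI P)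
  fix Q assume Q: "prime_filter Q \<and> Q \<subseteq> P"
  have "x \<in> Q" if x: "x \<in> P" for x
  proof -
    obtain y where "y \<notin> P" "sup x y = top" using assms(2)[OF x] by blast
    then show ?thesis
      using x Q rl_filter_top[of Q] unfolding prime_filter_def by (metis subsetD)
  qed
  with Q show "Q = P" by blast
qed

text \<open>Without such a \<open>y\<close>, some prime filter avoids both \<open>x\<close> and the
  complement of \<open>P\<close>, so it lies strictly inside \<open>P\<close>.\<close>

lemma minimal_prime_filterE:
  assumes P: "minimal_prime_filter P" and "x \<in> P"
  obtains y where "y \<notin> P" "sup x y = top"
proof (rule ccontr)
  assume "\<not> thesis"
  with that have no: "\<And>y. y \<notin> P \<Longrightarrow> sup x y \<noteq> top" by blast
  have prime: "prime_filter P" using P by (simp add: minimal_prime_filter_def)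
  \<comment> \<open>Since \<open>bot\<close> is not in \<open>P\<close>, this set contains
    \<open>x = sup x bot\<close>; primeness of \<open>P\<close> makes it closed under joins.\<close>
  let ?D = "- P \<union> sup x ` (- P)"
  have top: "top \<in> P" using prime rl_filter_top unfolding prime_filter_def by blast
  have compl: "sup a b \<notin> P" if "a \<notin> P" "b \<notin> P" for a b
    using prime that by (auto simp: prime_filter_def)
  have disj: "{top} \<inter> ?D = {}"
    using no top by auto metis
  have closed: "sup a b \<in> ?D" if ab: "a \<in> ?D" "b \<in> ?D" for a b
  proof -
    obtain a' b' where "a' \<notin> P" "a = a' \<or> a = sup x a'" "b' \<notin> P" "b = b' \<or> b = sup x b'"
      using ab by blast
    then have "sup a' b' \<notin> P" "sup a b = sup a' b' \<or> sup a b = sup x (sup a' b')"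
      using compl by (auto simp: ac_simps)
    then show ?thesis by (metis ComplI UnCI imageI)
  qed
  have bot: "bot \<notin> P" using prime by (rule prime_filter_bot)
  then have "?D \<noteq> {}" by blast
  with disj closed obtain Q where Q: "prime_filter Q" "Q \<inter> ?D = {}"
    using prime_filter_avoiding[OF rl_filter_singleton_top] by metis
  then have "Q = P" using P unfolding minimal_prime_filter_def by blast
  moreover have "x \<in> ?D" using bot by (auto intro: image_eqI[of _ _ bot])
  ultimately show False using Q(2) \<open>x \<in> P\<close> by blast
qed

section \<open>Quasicomplements\<close>

lemma minimal_prime_filter_if_quasicomplemented:
  fixes P :: "'a::residuated_lattice set"
  assumes "quasicomplemented TYPE('a)" and P: "prime_filter P" and "\<forall>x\<in>P. \<not> dense_element x"
  shows "minimal_prime_filter P"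
proof (rule minimal_prime_filterI[OF P])
  fix x assume x: "x \<in> P"
  obtain y where y: "perp (perp {x}) = perp {y}"
    using assms(1) unfolding quasicomplemented_def by blast
  have "x \<in> perp (perp {x})" by (auto simp: perp_def sup_commute)
  then have xy: "sup x y = top" unfolding y by (simp add: perp_def)
  have "dense_element (x \<odot> y)"
    unfolding dense_element_iff sup_odot_eq_top_iff
  proof (intro allI impI)
    fix a assume a: "sup a x = top \<and> sup a y = top"
    then have "a \<in> perp {x}" "a \<in> perp (perp {x})"
      unfolding y by (simp_all add: mem_perp_singleton)
    then have "sup a a = top" unfolding perp_def[of "perp {x}"] by blast
    then show "a = top" by simp
  qed
  then have "y \<notin> P"
    using assms(3) P x rl_filter_odot unfolding prime_filter_def by blast
  with xy show "\<exists>y. y \<notin> P \<and> sup x y = top" by blast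
qed

lemma quasicomplementedI:
  assumes H: "\<And>F :: 'a::residuated_lattice set. rl_filter F \<Longrightarrow> \<forall>x\<in>F. \<not> dense_element x \<Longrightarrow>
      \<exists>M. minimal_prime_filter M \<and> F \<subseteq> M"
  shows "quasicomplemented TYPE('a)"
  unfolding quasicomplemented_def
proof
  fix x :: 'a
  \<comment> \<open>The union of \<open>perp (perp {x, y})\<close> over all \<open>y\<close> in
    \<open>perp {x}\<close>, with the perps unfolded.\<close>
  define F where
    "F = {z. \<exists>y. sup x y = top \<and> (\<forall>w. sup w x = top \<and> sup w y = top \<longrightarrow> sup w z = top)}"
  have "rl_filter F"
  proof (rule rl_filterI)
    show "top \<in> F" unfolding F_def by (auto intro: exI[of _ top])
  next
    fix a b assume "a \<in> F" "b \<in> F"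
    then obtain y z where "sup x y = top" "sup x z = top"
      "\<And>w. sup w x = top \<and> sup w y = top \<Longrightarrow> sup w a = top"
      "\<And>w. sup w x = top \<and> sup w z = top \<Longrightarrow> sup w b = top"
      unfolding F_def by blast
    \<comment> \<open>The witness \<open>y \<odot> z\<close> is again in \<open>perp {x}\<close>,
      and whatever joins to \<open>top\<close> with it does so with both \<open>y\<close> and
      \<open>z\<close>.\<close>
    then show "a \<odot> b \<in> F"
      unfolding F_def by (auto simp: sup_odot_eq_top_iff intro!: exI[of _ "y \<odot> z"])
  next
    fix a b assume "a \<in> F"
    then show "sup a b \<in> F"
      unfolding F_def mem_Collect_eq by (metis sup_assoc sup_top_left)
  qed
  moreover have "\<not> (minimal_prime_filter M \<and> F \<subseteq> M)" for M
  proof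
    assume M: "minimal_prime_filter M \<and> F \<subseteq> M"
    \<comment> \<open>\<open>F\<close> contains \<open>x\<close> and all of \<open>perp {x}\<close>,
      but a minimal prime filter containing \<open>x\<close> misses some member of
      \<open>perp {x}\<close>.\<close>
    have "x \<in> F" unfolding F_def by (auto intro: exI[of _ top])
    with M obtain y where "y \<notin> M" "sup x y = top"
      using minimal_prime_filterE by blast
    moreover from this have "y \<in> F" unfolding F_def by blast
    ultimately show False using M by blast
  qed
  ultimately obtain d where "d \<in> F" and dense: "dense_element d"
    using H by blast
  then obtain y where y: "sup x y = top"
    and d: "\<And>w. sup w x = top \<Longrightarrow> sup w y = top \<Longrightarrow> sup w d = top"
    unfolding F_def by blast
  have "perp (perp {x}) = perp {y}"
  proof
    show "perp (perp {x}) \<subseteq> perp {y}"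
      using y unfolding perp_def by (auto simp: sup_commute)
  next
    show "perp {y} \<subseteq> perp (perp {x})"
    proof
      fix a assume "a \<in> perp {y}"
      then have a: "sup a y = top" by (simp add: perp_def)
      have "sup a b = top" if b: "sup b x = top" for b
      proof -
        \<comment> \<open>As \<open>sup a b\<close> joins to \<open>top\<close> with both
          \<open>x\<close> and \<open>y\<close>, it does so with \<open>d\<close>, and density of
          \<open>d\<close> makes it \<open>top\<close>.\<close>
        have "sup (sup a b) x = top" using b by (simp add: sup_assoc)
        moreover have "sup (sup a b) y = top" using a by (metis sup_assoc sup_commute sup_top_left)
        ultimately show ?thesis
          using d dense unfolding dense_element_iff by blast
      qed
      then show "a \<in> perp (perp {x})" by (simp add: perp_def)
    qed
  qed
  then show "\<exists>y. perp (perp {x}) = perp {y}" by blast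
qed

theorem proposition3p4:
  shows "(quasicomplemented TYPE('a::residuated_lattice) \<longleftrightarrow>
           (\<forall>P :: 'a set. prime_filter P \<and> (\<forall>x\<in>P. \<not> dense_element x) \<longrightarrow> minimal_prime_filter P))
       \<and> ((\<forall>P :: 'a set. prime_filter P \<and> (\<forall>x\<in>P. \<not> dense_element x) \<longrightarrow> minimal_prime_filter P) \<longleftrightarrow>
           (\<forall>F :: 'a set. rl_filter F \<and> (\<forall>x\<in>F. \<not> dense_element x) \<longrightarrow>
              (\<exists>M. minimal_prime_filter M \<and> F \<subseteq> M)))"
proof -
  let ?prime = "\<forall>P :: 'a set. prime_filter P \<and> (\<forall>x\<in>P. \<not> dense_element x) \<longrightarrow> minimal_prime_filter P"
  let ?filter = "\<forall>F :: 'a set. rl_filter F \<and> (\<forall>x\<in>F. \<not> dense_element x) \<longrightarrow>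
      (\<exists>M. minimal_prime_filter M \<and> F \<subseteq> M)"
  have "quasicomplemented TYPE('a) \<Longrightarrow> ?prime"
    using minimal_prime_filter_if_quasicomplemented by blast
  moreover have ?filter if prime: ?prime
  proof (intro allI impI)
    fix F :: "'a set" assume F: "rl_filter F \<and> (\<forall>x\<in>F. \<not> dense_element x)"
    obtain P where "prime_filter P" "F \<subseteq> P" "P \<inter> {x. dense_element x} = {}"
    proof (rule prime_filter_avoiding[of F "{x. dense_element x}"])
      \<comment> \<open>The least element is always dense.\<close>
      show "{x::'a. dense_element x} \<noteq> {}" using dense_element_bot by blast
    qed (use F dense_element_sup in auto)
    with prime show "\<exists>M. minimal_prime_filter M \<and> F \<subseteq> M" by blast
  qed
  moreover have "?filter \<Longrightarrow> quasicomplemented TYPE('a)"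
    by (rule quasicomplementedI) blast
  ultimately show ?thesis by blast
qed

end
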